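(* Let $(\mathscr{A},\mathscr{E})$ be an exact category. If $\mathscr{A}$ has enough projectives, then every object $A\in\mathscr{A}$ has a projective resolution.
   Context: A kernel-cokernel pair in an additive category $\mathscr{A}$ is a pair of composable morphisms $A'\xrightarrow{i}A\xrightarrow{p}A''$ such that $i$ is a kernel of $p$ and $p$ is a cokernel of $i$. Given a class $\mathscr{E}$ of kernel-cokernel pairs, an admissible monic is a morphism $i$ for which there is $p$ with $(i,p)\in\mathscr{E}$; an admissible epic is a morphism $p$ for which there is $i$ with $(i,p)\in\mathscr{E}$. An exact structure on $\mathscr{A}$ is a class $\mathscr{E}$ of kernel-cokernel pairs closed under isomorphisms such that: all identity morphisms are admissible monics and admissible epics; admissible monics are closed under composition and admissible epics are closed under composition; the push-out of an admissible monic along an arbitrary morphism exists and yields an admissible monic; the pull-back of an admissible epic along an arbitrary morphism exists and yields an admissible epic. An exact category is a pair $(\mathscr{A},\mathscr{E})$ of an additive category and an exact structure on it; elements of $\mathscr{E}$ are called short exact sequences. An object $P$ is projective if $\mathrm{Hom}_{\mathscr{A}}(P,-):\mathscr{A}\to\mathbf{Ab}$ sends short exact sequences of $\mathscr{E}$ to short exact sequences of abelian groups. $\mathscr{A}$ has enough projectives if for every object $A$ there exist a projective object $P$ and an admissible epic $P\to A$. A complex is exact (acyclic) if each differential factors as an admissible epic followed by an admissible monic, $X_{n+1}\to Z_n\to X_n$, in such a way that each sequence $Z_n\to X_n\to Z_{n-1}$ is in $\mathscr{E}$. A projective resolution of $A$ is a complex $P_\bullet$ of projective objects with $P_n=0$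 for $n<0$ together with a morphism $P_0\to A$ such that the augmented complex $\cdots\to P_1\to P_0\to A\to 0$ is exact. *)

theory Defs
  imports "HOL-Algebra.Exact_Sequence"
begin

section \<open>Additive categories\<close>

text \<open>
  A morphism determines its domain and codomain, so hom-sets are pairwise disjoint.
  All operations are only meaningful on composable (respectively parallel) morphisms
  from \<open>Arr\<close>; \<open>Zero A B\<close> is the neutral element of the group of morphisms from \<open>A\<close> to \<open>B\<close>.
\<close>

record ('o, 'm) additive_data =
  Obj :: "'o set"
  Arr :: "'m set"
  Dom :: "'m \<Rightarrow> 'o"
  Cod :: "'m \<Rightarrow> 'o"
  Ident :: "'o \<Rightarrow> 'm"
  Comp :: "'m \<Rightarrow> 'm \<Rightarrow> 'm"  (infixr \<open>\<cdot>\<index>\<close> 70)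
  Plus :: "'m \<Rightarrow> 'm \<Rightarrow> 'm"
  Zero :: "'o \<Rightarrow> 'o \<Rightarrow> 'm"

definition homset :: "('o, 'm) additive_data \<Rightarrow> 'o \<Rightarrow> 'o \<Rightarrow> 'm set" where
  "homset C A B = {f \<in> Arr C. Dom C f = A \<and> Cod C f = B}"

text \<open>The group is written multiplicatively because HOL-Algebra's theory of exact
  sequences of groups is; its multiplication is the addition of morphisms.\<close>

definition hom_group :: "('o, 'm) additive_data \<Rightarrow> 'o \<Rightarrow> 'o \<Rightarrow> 'm monoid" where
  "hom_group C A B = \<lparr>carrier = homset C A B, monoid.mult = Plus C, one = Zero C A B\<rparr>"

locale category =
  fixes C :: "('o, 'm) additive_data" (structure)
  assumes Dom_closed: "f \<in> Arr C \<Longrightarrow> Dom C f \<in> Obj C"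
    and Cod_closed: "f \<in> Arr C \<Longrightarrow> Cod C f \<in> Obj C"
    and Ident_closed: "A \<in> Obj C \<Longrightarrow> Ident C A \<in> homset C A A"
    and Comp_closed: "\<lbrakk>f \<in> homset C A B; g \<in> homset C B D\<rbrakk> \<Longrightarrow> g \<cdot> f \<in> homset C A D"
    and Comp_assoc:
      "\<lbrakk>f \<in> homset C A B; g \<in> homset C B D; h \<in> homset C D F\<rbrakk>
        \<Longrightarrow> h \<cdot> (g \<cdot> f) = (h \<cdot> g) \<cdot> f"
    and Comp_Ident_right: "f \<in> homset C A B \<Longrightarrow> f \<cdot> Ident C A = f"
    and Comp_Ident_left: "f \<in> homset C A B \<Longrightarrow> Ident C B \<cdot> f = f"

locale preadditive_category = category +
  assumes hom_comm_group:
      "\<lbrakk>A \<in> Obj C; B \<in> Obj C\<rbrakk> \<Longrightarrow> comm_group (hom_group C A B)"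
    and postcomp_hom:
      "\<lbrakk>g \<in> homset C B D; A \<in> Obj C\<rbrakk>
        \<Longrightarrow> (\<lambda>f. g \<cdot> f) \<in> hom (hom_group C A B) (hom_group C A D)"
    and precomp_hom:
      "\<lbrakk>f \<in> homset C A B; D \<in> Obj C\<rbrakk>
        \<Longrightarrow> (\<lambda>g. g \<cdot> f) \<in> hom (hom_group C B D) (hom_group C A D)"

definition is_zero_object :: "('o, 'm) additive_data \<Rightarrow> 'o \<Rightarrow> bool" where
  "is_zero_object C Z \<longleftrightarrow> Z \<in> Obj C \<and>
     (\<forall>A\<in>Obj C. (\<exists>!f. f \<in> homset C A Z) \<and> (\<exists>!f. f \<in> homset C Z A))"

definition is_biproduct ::
    "('o, 'm) additive_data \<Rightarrow> 'o \<Rightarrow> 'o \<Rightarrow> 'o \<Rightarrow> 'm \<Rightarrow> 'm \<Rightarrow> 'm \<Rightarrow> 'm \<Rightarrow> bool" where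
  "is_biproduct C A B S i\<^sub>A i\<^sub>B p\<^sub>A p\<^sub>B \<longleftrightarrow>
     S \<in> Obj C \<and>
     i\<^sub>A \<in> homset C A S \<and> i\<^sub>B \<in> homset C B S \<and>
     p\<^sub>A \<in> homset C S A \<and> p\<^sub>B \<in> homset C S B \<and>
     p\<^sub>A \<cdot>\<^bsub>C\<^esub> i\<^sub>A = Ident C A \<and> p\<^sub>B \<cdot>\<^bsub>C\<^esub> i\<^sub>B = Ident C B \<and>
     p\<^sub>B \<cdot>\<^bsub>C\<^esub> i\<^sub>A = Zero C A B \<and> p\<^sub>A \<cdot>\<^bsub>C\<^esub> i\<^sub>B = Zero C B A \<and>
     Plus C (i\<^sub>A \<cdot>\<^bsub>C\<^esub> p\<^sub>A) (i\<^sub>B \<cdot>\<^bsub>C\<^esub> p\<^sub>B) = Ident C S"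

locale additive_category = preadditive_category +
  assumes zero_object_exists: "\<exists>Z. is_zero_object C Z"
    and biproduct_exists:
      "\<lbrakk>A \<in> Obj C; B \<in> Obj C\<rbrakk>
        \<Longrightarrow> \<exists>S i\<^sub>A i\<^sub>B p\<^sub>A p\<^sub>B. is_biproduct C A B S i\<^sub>A i\<^sub>B p\<^sub>A p\<^sub>B"

definition is_iso :: "('o, 'm) additive_data \<Rightarrow> 'm \<Rightarrow> bool" where
  "is_iso C f \<longleftrightarrow> f \<in> Arr C \<and>
     (\<exists>g \<in> homset C (Cod C f) (Dom C f).
        g \<cdot>\<^bsub>C\<^esub> f = Ident C (Dom C f) \<and> f \<cdot>\<^bsub>C\<^esub> g = Ident C (Cod C f))"


section \<open>Exact categories\<close>

definition is_kernel :: "('o, 'm) additive_data \<Rightarrow> 'm \<Rightarrow> 'm \<Rightarrow> bool" where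
  "is_kernel C i p \<longleftrightarrow>
     i \<in> Arr C \<and> p \<in> Arr C \<and> Cod C i = Dom C p \<and>
     p \<cdot>\<^bsub>C\<^esub> i = Zero C (Dom C i) (Cod C p) \<and>
     (\<forall>f\<in>Arr C. Cod C f = Dom C p \<and> p \<cdot>\<^bsub>C\<^esub> f = Zero C (Dom C f) (Cod C p) \<longrightarrow>
        (\<exists>!g. g \<in> homset C (Dom C f) (Dom C i) \<and> i \<cdot>\<^bsub>C\<^esub> g = f))"

definition is_cokernel :: "('o, 'm) additive_data \<Rightarrow> 'm \<Rightarrow> 'm \<Rightarrow> bool" where
  "is_cokernel C p i \<longleftrightarrow>
     i \<in> Arr C \<and> p \<in> Arr C \<and> Cod C i = Dom C p \<and>
     p \<cdot>\<^bsub>C\<^esub> i = Zero C (Dom C i) (Cod C p) \<and>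
     (\<forall>f\<in>Arr C. Dom C f = Cod C i \<and> f \<cdot>\<^bsub>C\<^esub> i = Zero C (Dom C i) (Cod C f) \<longrightarrow>
        (\<exists>!g. g \<in> homset C (Cod C p) (Cod C f) \<and> g \<cdot>\<^bsub>C\<^esub> p = f))"

definition kernel_cokernel_pair :: "('o, 'm) additive_data \<Rightarrow> 'm \<Rightarrow> 'm \<Rightarrow> bool" where
  "kernel_cokernel_pair C i p \<longleftrightarrow> is_kernel C i p \<and> is_cokernel C p i"

definition isomorphic_pairs ::
    "('o, 'm) additive_data \<Rightarrow> 'm \<times> 'm \<Rightarrow> 'm \<times> 'm \<Rightarrow> bool" where
  "isomorphic_pairs C = (\<lambda>(i, p) (j, q).
     \<exists>a b c. is_iso C a \<and> is_iso C b \<and> is_iso C c \<and>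
       a \<in> homset C (Dom C i) (Dom C j) \<and>
       b \<in> homset C (Cod C i) (Cod C j) \<and>
       c \<in> homset C (Cod C p) (Cod C q) \<and>
       b \<cdot>\<^bsub>C\<^esub> i = j \<cdot>\<^bsub>C\<^esub> a \<and> c \<cdot>\<^bsub>C\<^esub> p = q \<cdot>\<^bsub>C\<^esub> b)"

definition admissible_monic :: "('m \<times> 'm) set \<Rightarrow> 'm \<Rightarrow> bool" where
  "admissible_monic E i \<longleftrightarrow> (\<exists>p. (i, p) \<in> E)"

definition admissible_epic :: "('m \<times> 'm) set \<Rightarrow> 'm \<Rightarrow> bool" where
  "admissible_epic E p \<longleftrightarrow> (\<exists>i. (i, p) \<in> E)"

text \<open>In \<open>is_pushout C i f i' f'\<close> the morphism \<open>i'\<close> is parallel to \<open>i\<close>, i.e. it is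
  the push-out of \<open>i\<close> along \<open>f\<close>; likewise \<open>p'\<close> in \<open>is_pullback C p f p' f'\<close> is the
  pull-back of \<open>p\<close> along \<open>f\<close>.\<close>

definition is_pushout ::
    "('o, 'm) additive_data \<Rightarrow> 'm \<Rightarrow> 'm \<Rightarrow> 'm \<Rightarrow> 'm \<Rightarrow> bool" where
  "is_pushout C i f i' f' \<longleftrightarrow>
     i \<in> Arr C \<and> f \<in> Arr C \<and> i' \<in> Arr C \<and> f' \<in> Arr C \<and>
     Dom C i = Dom C f \<and> Dom C f' = Cod C i \<and> Dom C i' = Cod C f \<and> Cod C i' = Cod C f' \<and>
     f' \<cdot>\<^bsub>C\<^esub> i = i' \<cdot>\<^bsub>C\<^esub> f \<and>
     (\<forall>u\<in>Arr C. \<forall>v\<in>Arr C.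
        Dom C u = Cod C i \<and> Dom C v = Cod C f \<and> Cod C u = Cod C v \<and>
        u \<cdot>\<^bsub>C\<^esub> i = v \<cdot>\<^bsub>C\<^esub> f \<longrightarrow>
        (\<exists>!w. w \<in> homset C (Cod C i') (Cod C u) \<and> w \<cdot>\<^bsub>C\<^esub> f' = u \<and> w \<cdot>\<^bsub>C\<^esub> i' = v))"

definition is_pullback ::
    "('o, 'm) additive_data \<Rightarrow> 'm \<Rightarrow> 'm \<Rightarrow> 'm \<Rightarrow> 'm \<Rightarrow> bool" where
  "is_pullback C p f p' f' \<longleftrightarrow>
     p \<in> Arr C \<and> f \<in> Arr C \<and> p' \<in> Arr C \<and> f' \<in> Arr C \<and>
     Cod C p = Cod C f \<and> Cod C f' = Dom C p \<and> Cod C p' = Dom C f \<and> Dom C p' = Dom C f' \<and>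
     p \<cdot>\<^bsub>C\<^esub> f' = f \<cdot>\<^bsub>C\<^esub> p' \<and>
     (\<forall>u\<in>Arr C. \<forall>v\<in>Arr C.
        Cod C u = Dom C p \<and> Cod C v = Dom C f \<and> Dom C u = Dom C v \<and>
        p \<cdot>\<^bsub>C\<^esub> u = f \<cdot>\<^bsub>C\<^esub> v \<longrightarrow>
        (\<exists>!w. w \<in> homset C (Dom C u) (Dom C p') \<and> f' \<cdot>\<^bsub>C\<^esub> w = u \<and> p' \<cdot>\<^bsub>C\<^esub> w = v))"

locale exact_category = additive_category +
  fixes E :: "('m \<times> 'm) set"
  assumes kernel_cokernel: "(i, p) \<in> E \<Longrightarrow> kernel_cokernel_pair C i p"
    and iso_closed:
      "\<lbrakk>(i, p) \<in> E; j \<in> Arr C; q \<in> Arr C; Cod C j = Dom C q;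
        isomorphic_pairs C (i, p) (j, q)\<rbrakk> \<Longrightarrow> (j, q) \<in> E"
    and Ident_admissible_monic: "A \<in> Obj C \<Longrightarrow> admissible_monic E (Ident C A)"
    and Ident_admissible_epic: "A \<in> Obj C \<Longrightarrow> admissible_epic E (Ident C A)"
    and Comp_admissible_monic:
      "\<lbrakk>admissible_monic E i; admissible_monic E j; Cod C i = Dom C j\<rbrakk>
        \<Longrightarrow> admissible_monic E (j \<cdot> i)"
    and Comp_admissible_epic:
      "\<lbrakk>admissible_epic E p; admissible_epic E q; Cod C p = Dom C q\<rbrakk>
        \<Longrightarrow> admissible_epic E (q \<cdot> p)"
    and pushout_admissible_monic:
      "\<lbrakk>admissible_monic E i; f \<in> Arr C; Dom C f = Dom C i\<rbrakk>
        \<Longrightarrow> \<exists>i' f'. is_pushout C i f i' f' \<and> admissible_monic E i'"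
    and pullback_admissible_epic:
      "\<lbrakk>admissible_epic E p; f \<in> Arr C; Cod C f = Cod C p\<rbrakk>
        \<Longrightarrow> \<exists>p' f'. is_pullback C p f p' f' \<and> admissible_epic E p'"


section \<open>Projective objects and resolutions\<close>

text \<open>\<open>short_exact_sequence\<close> lists its groups from right to left: the sequence below is
  \<open>0 \<rightarrow> Hom(P, A') \<rightarrow> Hom(P, A) \<rightarrow> Hom(P, A'') \<rightarrow> 0\<close> with maps \<open>i \<cdot> _\<close> and \<open>p \<cdot> _\<close>.\<close>

definition projective ::
    "('o, 'm) additive_data \<Rightarrow> ('m \<times> 'm) set \<Rightarrow> 'o \<Rightarrow> bool" where
  "projective C E P \<longleftrightarrow> P \<in> Obj C \<and>
     (\<forall>(i, p) \<in> E.
        short_exact_sequence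
          (hom_group C P (Cod C p)) (hom_group C P (Dom C p)) (hom_group C P (Dom C i))
          (\<lambda>f. p \<cdot>\<^bsub>C\<^esub> f) (\<lambda>f. i \<cdot>\<^bsub>C\<^esub> f))"

definition enough_projectives ::
    "('o, 'm) additive_data \<Rightarrow> ('m \<times> 'm) set \<Rightarrow> bool" where
  "enough_projectives C E \<longleftrightarrow>
     (\<forall>A\<in>Obj C. \<exists>P p. projective C E P \<and> p \<in> homset C P A \<and> admissible_epic E p)"

text \<open>Complexes are indexed by the integers, with \<open>d n\<close> going from \<open>X n\<close> to \<open>X (n - 1)\<close>.\<close>

definition chain_complex ::
    "('o, 'm) additive_data \<Rightarrow> (int \<Rightarrow> 'o) \<Rightarrow> (int \<Rightarrow> 'm) \<Rightarrow> bool" where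
  "chain_complex C X d \<longleftrightarrow>
     (\<forall>n. X n \<in> Obj C \<and> d n \<in> homset C (X n) (X (n - 1)) \<and>
          d n \<cdot>\<^bsub>C\<^esub> d (n + 1) = Zero C (X (n + 1)) (X (n - 1)))"

definition exact_complex ::
    "('o, 'm) additive_data \<Rightarrow> ('m \<times> 'm) set \<Rightarrow> (int \<Rightarrow> 'o) \<Rightarrow> (int \<Rightarrow> 'm) \<Rightarrow> bool" where
  "exact_complex C E X d \<longleftrightarrow> chain_complex C X d \<and>
     (\<exists>Z e m. \<forall>n.
        e n \<in> homset C (X (n + 1)) (Z n) \<and> admissible_epic E (e n) \<and>
        m n \<in> homset C (Z n) (X n) \<and> admissible_monic E (m n) \<and>
        d (n + 1) = m n \<cdot>\<^bsub>C\<^esub> e n \<and>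
        (m n, e (n - 1)) \<in> E)"

text \<open>The augmented complex has \<open>A\<close> in degree \<open>-1\<close>; for a resolution, the terms \<open>P n\<close> kept
  in degrees \<open>n < -1\<close> are zero objects.\<close>

definition augmented_obj :: "(int \<Rightarrow> 'o) \<Rightarrow> 'o \<Rightarrow> int \<Rightarrow> 'o" where
  "augmented_obj P A n = (if n = -1 then A else P n)"

definition augmented_diff ::
    "('o, 'm) additive_data \<Rightarrow> (int \<Rightarrow> 'o) \<Rightarrow> (int \<Rightarrow> 'm) \<Rightarrow> 'o \<Rightarrow> 'm \<Rightarrow> int \<Rightarrow> 'm" where
  "augmented_diff C P d A \<epsilon> n =
     (if n = 0 then \<epsilon> else if n = -1 then Zero C A (P (-2)) else d n)"

definition projective_resolution ::
    "('o, 'm) additive_data \<Rightarrow> ('m \<times> 'm) set \<Rightarrow> 'o \<Rightarrow> (int \<Rightarrow> 'o) \<Rightarrow> (int \<Rightarrow> 'm) \<Rightarrow> 'm \<Rightarrow> bool"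
  where
  "projective_resolution C E A P d \<epsilon> \<longleftrightarrow>
     chain_complex C P d \<and>
     (\<forall>n. projective C E (P n)) \<and>
     (\<forall>n<0. is_zero_object C (P n)) \<and>
     \<epsilon> \<in> homset C (P 0) A \<and>
     exact_complex C E (augmented_obj P A) (augmented_diff C P d A \<epsilon>)"

end

theory Submission
  imports Defs
begin

text \<open>
  Cover \<open>A\<close> by a projective \<open>P\<^sub>0\<close>, then the kernel \<open>K\<^sub>1\<close> of \<open>P\<^sub>0 \<rightarrow> A\<close> by a projective \<open>P\<^sub>1\<close>, and so
  on. Splicing the short exact sequences \<open>K\<^sub>n\<^sub>+\<^sub>1 \<rightarrow> P\<^sub>n \<rightarrow> K\<^sub>n\<close> gives the resolution; below degree 0
  it is continued by \<open>A \<rightarrow> A \<rightarrow> 0\<close>, which is short exact because the cokernel of an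
  identity is a zero object.
\<close>

section \<open>Homsets, zero morphisms and zero objects\<close>

context category
begin

lemma homsetD:
  assumes "f \<in> homset C A B"
  shows "f \<in> Arr C" "Dom C f = A" "Cod C f = B" "A \<in> Obj C" "B \<in> Obj C"
  using assms Dom_closed Cod_closed by (auto simp: homset_def)

lemma Ident_is_iso: "A \<in> Obj C \<Longrightarrow> is_iso C (Ident C A)"
  using Ident_closed[of A] homsetD[OF Ident_closed[of A]] Comp_Ident_left[of "Ident C A" A A]
  unfolding is_iso_def by auto

end

context preadditive_category
begin

lemma Zero_closed:
  assumes "A \<in> Obj C" "B \<in> Obj C"
  shows "Zero C A B \<in> homset C A B"
proof -
  interpret G: comm_group "hom_group C A B"
    using hom_comm_group assms .
  show ?thesis
    using G.one_closed by (simp add: hom_group_def)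
qed

lemma Comp_Zero_right:
  assumes "g \<in> homset C B D" "A \<in> Obj C"
  shows "g \<cdot> Zero C A B = Zero C A D"
proof -
  have "comm_group (hom_group C A B)" "comm_group (hom_group C A D)"
    using assms homsetD[OF assms(1)] hom_comm_group by auto
  from hom_one[OF postcomp_hom[OF assms]] this show ?thesis
    by (simp add: hom_group_def comm_group_def)
qed

lemma Comp_Zero_left:
  assumes "f \<in> homset C A B" "D \<in> Obj C"
  shows "Zero C B D \<cdot> f = Zero C A D"
proof -
  have "comm_group (hom_group C B D)" "comm_group (hom_group C A D)"
    using assms homsetD[OF assms(1)] hom_comm_group by auto
  from hom_one[OF precomp_hom[OF assms]] this show ?thesis
    by (simp add: hom_group_def comm_group_def)
qed

lemma zero_object_hom_eq:
  assumes "is_zero_object C Z" "A \<in> Obj C"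
  shows "homset C A Z = {Zero C A Z}" "homset C Z A = {Zero C Z A}"
proof -
  have "Z \<in> Obj C" "\<exists>!f. f \<in> homset C A Z" "\<exists>!f. f \<in> homset C Z A"
    using assms by (auto simp: is_zero_object_def)
  then show "homset C A Z = {Zero C A Z}" "homset C Z A = {Zero C Z A}"
    using Zero_closed[of A Z] Zero_closed[of Z A] assms(2) by blast+
qed

end

section \<open>Short exact sequences: trivial cases and splicing\<close>

lemma short_exact_sequence_trivial_groups:
  assumes "trivial_group F" "trivial_group G" "trivial_group H"
    and "f \<in> hom G F" "g \<in> hom H G"
  shows "short_exact_sequence F G H f g"
proof -
  have grp: "group F" "group G" "group H"
    using assms by (auto simp: trivial_group_def)
  have one: "f \<one>\<^bsub>G\<^esub> = \<one>\<^bsub>F\<^esub>" "g \<one>\<^bsub>H\<^esub> = \<one>\<^bsub>G\<^esub>"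
    using hom_one assms(4,5) grp by blast+
  show ?thesis
    using assms grp one
    by (auto simp: short_exact_sequence_iff group_hom_def group_hom_axioms_def
        epi_def mon_def trivial_group_def kernel_def)
qed

context exact_category
begin

lemma short_exactD:
  assumes "(i, p) \<in> E"
  shows "i \<in> homset C (Dom C i) (Dom C p)" "p \<in> homset C (Dom C p) (Cod C p)"
    and "p \<cdot> i = Zero C (Dom C i) (Cod C p)"
  using kernel_cokernel[OF assms]
  by (auto simp: kernel_cokernel_pair_def is_kernel_def homset_def)

text \<open>The axioms only provide some partner \<open>p\<close> of the identity. As
  \<open>p\<close> composed with the identity is zero, \<open>p\<close> is zero; being a cokernel,
  it then has a zero object as codomain, and closure under isomorphism replaces that object by
  \<open>Z\<close>.\<close>

lemma Ident_Zero_short_exact: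
  assumes A: "A \<in> Obj C" and Z: "is_zero_object C Z"
  shows "(Ident C A, Zero C A Z) \<in> E"
proof -
  obtain p where p: "(Ident C A, p) \<in> E"
    using Ident_admissible_monic[OF A] by (auto simp: admissible_monic_def)
  note I = Ident_closed[OF A] and Z_Obj = Z[unfolded is_zero_object_def, THEN conjunct1]
  define B where "B = Cod C p"
  have p_hom: "p \<in> homset C A B"
    using short_exactD(2)[OF p] homsetD[OF short_exactD(1)[OF p]] homsetD[OF I] by (simp add: B_def)
  note B = homsetD(5)[OF p_hom]
  have p_Zero: "p = Zero C A B"
    using short_exactD(3)[OF p] Comp_Ident_right[OF p_hom] homsetD[OF I] by (simp add: B_def)
  \<comment> \<open>The cokernel property applied to \<open>p\<close> itself; both
    \<open>Zero C B B\<close> and \<open>Ident C B\<close> solve this equation, so they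
    agree.\<close>
  have uniq: "\<exists>!g. g \<in> homset C B B \<and> g \<cdot> p = p"
  proof -
    have "p \<cdot> Ident C A = Zero C (Dom C (Ident C A)) (Cod C p)"
      using short_exactD(3)[OF p] .
    moreover have "Dom C p = Cod C (Ident C A)"
      using homsetD(2)[OF p_hom] homsetD(3)[OF I] by simp
    ultimately have "\<exists>!g. g \<in> homset C (Cod C p) (Cod C p) \<and> g \<cdot> p = p"
      using kernel_cokernel[OF p] homsetD(1)[OF p_hom]
      unfolding kernel_cokernel_pair_def is_cokernel_def by blast
    then show ?thesis
      unfolding B_def .
  qed
  have "Zero C B B \<cdot> p = p" "Ident C B \<cdot> p = p"
    using Comp_Zero_left[OF p_hom B] p_Zero[symmetric] Comp_Ident_left[OF p_hom] by simp_all
  then have ZI: "Zero C B B = Ident C B"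
    using uniq Zero_closed[OF B B] Ident_closed[OF B] by blast
  have ZZ: "Zero C Z Z = Ident C Z"
    using zero_object_hom_eq[OF Z Z_Obj] Ident_closed[OF Z_Obj] by auto
  have BZ: "Zero C B Z \<in> homset C B Z" and ZB: "Zero C Z B \<in> homset C Z B"
    using Zero_closed B Z_Obj by blast+
  \<comment> \<open>Composites in either order are zero endomorphisms, which are the identities of
    \<open>B\<close> and \<open>Z\<close>; hence the two zero morphisms are mutually
    inverse.\<close>
  have iso: "is_iso C (Zero C B Z)"
    unfolding is_iso_def homsetD(2,3)[OF BZ] using homsetD(1)[OF BZ] ZB Comp_Zero_right[OF ZB B]
      Comp_Zero_right[OF BZ Z_Obj] ZI ZZ by (intro conjI bexI[OF _ ZB]) simp_all
  have AZ: "Zero C A Z \<in> homset C A Z"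
    using Zero_closed A Z_Obj by blast
  have "isomorphic_pairs C (Ident C A, p) (Ident C A, Zero C A Z)"
    unfolding isomorphic_pairs_def prod.case homsetD(2,3)[OF I] homsetD(3)[OF p_hom]
      homsetD(3)[OF AZ]
    using iso Ident_is_iso[OF A] I BZ Comp_Ident_right[OF AZ] Comp_Zero_left[OF p_hom Z_Obj]
    by (intro exI[of _ "Ident C A"] exI[of _ "Zero C B Z"] conjI)
      (simp_all add: p_Zero Comp_Zero_right[OF BZ A])
  then show ?thesis
    using iso_closed[OF p] homsetD(1,3)[OF I] homsetD(1,2)[OF AZ] by simp
qed

text \<open>All hom-groups out of \<open>Z\<close> are trivial, so Hom from \<open>Z\<close> turns
  any pair in \<open>E\<close> into a sequence of trivial groups. This serves the negative degrees
  of a resolution, whose terms must be projective too.\<close>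

lemma zero_object_projective:
  assumes Z: "is_zero_object C Z"
  shows "projective C E Z"
proof -
  have Z_Obj: "Z \<in> Obj C"
    using Z by (simp add: is_zero_object_def)
  have triv: "trivial_group (hom_group C Z B)" if "B \<in> Obj C" for B
    using hom_comm_group[OF Z_Obj that] zero_object_hom_eq(2)[OF Z that]
    by (simp add: trivial_group_def comm_group_def hom_group_def)
  show ?thesis
    unfolding projective_def
  proof (intro conjI ballI, goal_cases)
    case (2 ip)
    then obtain i p where ip: "ip = (i, p)" "(i, p) \<in> E"
      by (cases ip) auto
    note i = short_exactD(1)[OF ip(2)] and p = short_exactD(2)[OF ip(2)]
    show ?case
      unfolding ip(1) prod.case
      using triv homsetD(4,5)[OF i] homsetD(5)[OF p] postcomp_hom[OF i Z_Obj] postcomp_hom[OF p Z_Obj]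
      by (intro short_exact_sequence_trivial_groups)
  qed (rule Z_Obj)
qed

text \<open>The composite of consecutive differentials contains \<open>m n\<close> followed by
  \<open>e (n - 1)\<close>, which vanishes because the two form a pair in \<open>E\<close>; so the
  complex condition comes for free.\<close>

lemma spliced_exact_complex:
  assumes short_exact: "\<And>n. (m n, e (n - 1)) \<in> E"
    and m: "\<And>n. m n \<in> homset C (Z n) (X n)"
    and e: "\<And>n. e n \<in> homset C (X (n + 1)) (Z n)"
    and d: "\<And>n. d (n + 1) = m n \<cdot> e n"
  shows "exact_complex C E X d"
proof -
  have d': "d n = m (n - 1) \<cdot> e (n - 1)" and e': "e (n - 1) \<in> homset C (X n) (Z (n - 1))" for n
    using d[of "n - 1"] e[of "n - 1"] by simp_all
  \<comment> \<open>\<open>m n\<close> is the monic of the pair at \<open>n\<close>, while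
    \<open>e n\<close> is the epic of the pair at \<open>n + 1\<close>.\<close>
  have adm: "admissible_epic E (e n)" "admissible_monic E (m n)" for n
    using short_exact[of n] short_exact[of "n + 1"]
    by (auto simp: admissible_epic_def admissible_monic_def)
  have d_hom: "d n \<in> homset C (X n) (X (n - 1))" for n
    unfolding d' using Comp_closed[OF e' m] .
  have dd: "d n \<cdot> d (n + 1) = Zero C (X (n + 1)) (X (n - 1))" for n
  proof -
    have em: "e (n - 1) \<cdot> m n = Zero C (Z n) (Z (n - 1))"
      using short_exactD(3)[OF short_exact] homsetD(2)[OF m] homsetD(3)[OF e] by simp
    note X_Obj = homsetD(4)[OF e[of n]] and Z_Obj = homsetD(4)[OF m[of n]]
    have "d n \<cdot> d (n + 1) = m (n - 1) \<cdot> (e (n - 1) \<cdot> (m n \<cdot> e n))"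
      unfolding d'[of n] d using Comp_assoc[OF Comp_closed[OF e m] e' m] by simp
    also have "e (n - 1) \<cdot> (m n \<cdot> e n) = Zero C (X (n + 1)) (Z (n - 1))"
      using Comp_assoc[OF e m e'] em Comp_Zero_left[OF e homsetD(5)[OF e']] by simp
    also have "m (n - 1) \<cdot> \<dots> = Zero C (X (n + 1)) (X (n - 1))"
      using Comp_Zero_right[OF m X_Obj] .
    finally show ?thesis .
  qed
  have "chain_complex C X d"
    unfolding chain_complex_def using homsetD(4)[OF d_hom] d_hom dd by blast
  then show ?thesis
    unfolding exact_complex_def using short_exact m e d adm by blast
qed

section \<open>Iterated projective presentations\<close>

lemma projective_presentation:
  assumes "enough_projectives C E" "A \<in> Obj C"
  shows "\<exists>P p i. projective C E P \<and> p \<in> homset C P A \<and> i \<in> homset C (Dom C i) P \<and> (i, p) \<in> E"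
proof -
  obtain P p i where "projective C E P" "p \<in> homset C P A" "(i, p) \<in> E"
    using assms by (auto simp: enough_projectives_def admissible_epic_def)
  moreover from this have "i \<in> homset C (Dom C i) P"
    using short_exactD(1) homsetD(2) by fastforce
  ultimately show ?thesis by blast
qed

text \<open>Presentations are chosen as functions of the object; the next object to present is the
  kernel object of the previous presentation.\<close>

lemma iterated_projective_presentations:
  assumes "enough_projectives C E" and A: "A \<in> Obj C"
  obtains K P p i where "K 0 = A"
    and "\<And>n::nat. projective C E (P n)"
    and "\<And>n. p n \<in> homset C (P n) (K n)"
    and "\<And>n. i n \<in> homset C (K (Suc n)) (P n)"
    and "\<And>n. (i n, p n) \<in> E"
proof -
  obtain P p i where Ppi: "\<And>B. B \<in> Obj C \<Longrightarrow>
      projective C E (P B) \<and> p B \<in> homset C (P B) B \<and> i B \<in> homset C (Dom C (i B)) (P B) \<and>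
      (i B, p B) \<in> E"
    using projective_presentation[OF assms(1)] by metis
  define K where "K n = ((\<lambda>B. Dom C (i B)) ^^ n) A" for n :: nat
  \<comment> \<open>The choice functions are specified only on objects of the category, so the
    iterates must be shown to stay there.\<close>
  have "K n \<in> Obj C" for n
  proof (induction n)
    case (Suc n)
    then have "i (K n) \<in> homset C (Dom C (i (K n))) (P (K n))"
      using Ppi by blast
    from homsetD(4)[OF this] show ?case by (simp add: K_def)
  qed (simp add: K_def A)
  with Ppi show ?thesis
    by (intro that[of K "\<lambda>n. P (K n)" "\<lambda>n. p (K n)" "\<lambda>n. i (K n)"]) (auto simp: K_def)
qed

end

section \<open>Assembling the resolution over integer degrees\<close>

theorem proposition12p2:
  fixes C :: "('o, 'm) additive_data" and E :: "('m \<times> 'm) set"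
  assumes "exact_category C E"
    and "enough_projectives C E"
    and "A \<in> Obj C"
  shows "\<exists>P d \<epsilon>. projective_resolution C E A P d \<epsilon>"
proof -
  interpret exact_category C E by fact
  obtain O' where O': "is_zero_object C O'"
    using zero_object_exists by blast
  have O'_Obj: "O' \<in> Obj C"
    using O' by (simp add: is_zero_object_def)
  have Zero_O': "Zero C O' O' = Ident C O'"
    using zero_object_hom_eq[OF O' O'_Obj] Ident_closed[OF O'_Obj] by auto
  obtain K Q p i where K0: "K 0 = A" and Q: "\<And>n::nat. projective C E (Q n)"
    and p: "\<And>n. p n \<in> homset C (Q n) (K n)"
    and i: "\<And>n. i n \<in> homset C (K (Suc n)) (Q n)"
    and ip: "\<And>n. (i n, p n) \<in> E"
    using iterated_projective_presentations[OF assms(2,3)] by metis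
  define P where "P n = (if n < 0 then O' else Q (nat n))" for n
  define X where "X = augmented_obj P A"
  \<comment> \<open>\<open>Z n\<close> lies between \<open>X (n + 1)\<close> and \<open>X n\<close>,
    so \<open>K k\<close> occupies index \<open>k - 1\<close>; in particular \<open>Z (-1)\<close>
    is \<open>A\<close>.\<close>
  define Z where "Z n = (if n < -1 then O' else K (nat (n + 1)))" for n
  \<comment> \<open>In negative degrees \<open>Z n\<close> equals \<open>X n\<close>, which gives
    the pair from \<open>A\<close> to \<open>A\<close> to zero and, below it, pairs of zero
    objects.\<close>
  define m where "m n = (if n < 0 then Ident C (X n) else i (nat n))" for n
  \<comment> \<open>At \<open>n = -1\<close> this is the augmentation \<open>p 0\<close>.\<close>
  define e where "e n = (if n < -1 then Zero C (X (n + 1)) O' else p (nat (n + 1)))" for n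
  \<comment> \<open>\<open>d\<close> leaves out the augmentation: \<open>d 0\<close> maps into the
    zero object \<open>P (-1)\<close>, and splicing starts in degree 1.\<close>
  define d where "d n = (if n < 1 then Zero C (P n) (P (n - 1)) else m (n - 1) \<cdot>\<^bsub>C\<^esub> e (n - 1))" for n
  have P_proj: "projective C E (P n)" for n
    using Q zero_object_projective[OF O'] by (simp add: P_def)
  then have P_Obj: "P n \<in> Obj C" for n
    by (simp add: projective_def)
  have X_Obj: "X n \<in> Obj C" for n
    using P_Obj assms(3) by (simp add: X_def augmented_obj_def)
  have m_hom: "m n \<in> homset C (Z n) (X n)" for n
  proof (cases "n < 0")
    case True
    then have "Z n = X n"
      by (auto simp: Z_def X_def augmented_obj_def P_def K0)
    then show ?thesis
      using True Ident_closed[OF X_Obj] by (simp add: m_def)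
  next
    case False
    then have "Z n = K (Suc (nat n))" "X n = Q (nat n)"
      by (auto simp: Z_def X_def augmented_obj_def P_def nat_add_distrib)
    then show ?thesis
      using False i by (simp add: m_def)
  qed
  have e_hom: "e n \<in> homset C (X (n + 1)) (Z n)" for n
    using p Zero_closed[OF assms(3) O'_Obj] Zero_closed[OF O'_Obj O'_Obj]
    by (auto simp: e_def Z_def X_def augmented_obj_def P_def)
  have short_exact: "(m n, e (n - 1)) \<in> E" for n
    using ip Ident_Zero_short_exact[OF X_Obj O'] by (auto simp: m_def e_def)
  have diff: "augmented_diff C P d A (p 0) (n + 1) = m n \<cdot>\<^bsub>C\<^esub> e n" for n
  proof -
    \<comment> \<open>The differential has degree \<open>n + 1\<close>, so the cases are: the
      spliced differentials, the augmentation, the map from \<open>A\<close> to zero, and the zero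
      tail.\<close>
    consider "n \<ge> 0" | "n = -1" | "n = -2" | "n < -2" by linarith
    then show ?thesis
    proof cases
      case 1
      then show ?thesis by (simp add: augmented_diff_def d_def)
    next
      case 2
      then show ?thesis
        using Comp_Ident_left[OF p[of 0]]
        by (simp add: augmented_diff_def m_def e_def X_def augmented_obj_def K0)
    next
      case 3
      then show ?thesis
        using Comp_Ident_left[OF Zero_closed[OF assms(3) O'_Obj]]
        by (simp add: augmented_diff_def m_def e_def X_def augmented_obj_def P_def)
    next
      case 4
      then show ?thesis
        using Comp_Ident_left[OF Ident_closed[OF O'_Obj]]
        by (simp add: augmented_diff_def m_def e_def d_def X_def augmented_obj_def P_def Zero_O')
    qed
  qed
  have exact: "exact_complex C E X (augmented_diff C P d A (p 0))"
    using spliced_exact_complex[OF short_exact m_hom e_hom diff] .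
  \<comment> \<open>From degree 1 on, \<open>d\<close> agrees with the augmented differential, and
    \<open>P\<close> with \<open>X\<close> from degree 0 on, so these facts transfer to
    \<open>d\<close>; below degree 1, \<open>d\<close> is zero.\<close>
  have X_chain: "augmented_diff C P d A (p 0) n \<in> homset C (X n) (X (n - 1))"
    "augmented_diff C P d A (p 0) n \<cdot>\<^bsub>C\<^esub> augmented_diff C P d A (p 0) (n + 1)
      = Zero C (X (n + 1)) (X (n - 1))" for n
    using exact by (auto simp: exact_complex_def chain_complex_def)
  have d_hom: "d n \<in> homset C (P n) (P (n - 1))" for n
  proof (cases "n < 1")
    case True
    then show ?thesis using Zero_closed[OF P_Obj P_Obj] by (simp add: d_def)
  next
    case False
    then show ?thesis
      using X_chain(1)[of n] by (simp add: augmented_diff_def X_def augmented_obj_def)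
  qed
  have dd: "d n \<cdot>\<^bsub>C\<^esub> d (n + 1) = Zero C (P (n + 1)) (P (n - 1))" for n
  proof (cases "n < 1")
    case True
    then show ?thesis
      using Comp_Zero_left[OF d_hom[of "n + 1"] P_Obj[of "n - 1"]] by (simp add: d_def)
  next
    case False
    then show ?thesis
      using X_chain(2)[of n] by (simp add: augmented_diff_def X_def augmented_obj_def)
  qed
  have "chain_complex C P d"
    unfolding chain_complex_def using P_Obj d_hom dd by blast
  moreover have "is_zero_object C (P n)" if "n < 0" for n
    using that O' by (simp add: P_def)
  moreover have "p 0 \<in> homset C (P 0) A"
    using p[of 0] by (simp add: P_def K0)
  ultimately have "projective_resolution C E A P d (p 0)"
    unfolding projective_resolution_def using P_proj exact by (simp add: X_def)
  then show ?thesis by blast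
qed

end
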